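(* Let $\varphi:S^1\to S^1$ be an orientation preserving circle homeomorphism with $\varrho(\varphi)=\frac{p}{q}$ which has finitely many periodic points $\{z^1,z^2,\dots,z^r\}$. Fix $\varepsilon>0$ and consider the interval (open arc) $(z^k,z^{k+1})$ between two consecutive different periodic points $z^k$ and $z^{k+1}$ of $\varphi$. (a) Suppose that, within $(z^k,z^{k+1})$, $z^{k+1}$ is attracting (under $\varphi^q$) and $z^k$ is repelling. Then there exists a point $\widetilde z_k\in(z^k,z^{k+1})$ such that: 1) if $z\in B_k^+:=[\widetilde z_k,z^{k+1})$ and for some $n\in\mathbb{N}$ we have $|\varphi^{-nq-i}(z)-\varphi^{q-i}(z^k)|<\varepsilon$ for all $i=0,1,\dots,q-1$, then also $|\varphi^{nq+i}(z)-\varphi^{i}(z^{k+1})|<\varepsilon$ for all $i=0,1,\dots,q-1$; 2) if $z\in B_k^-:=(z^k,\widetilde z_k]$ and for some $n\in\mathbb{N}$ we have $|\varphi^{nq+i}(z)-\varphi^{i}(z^{k+1})|<\varepsilon$ for all $i=0,1,\dots,q-1$, then also $|\varphi^{-nq-i}(z)-\varphi^{q-i}(z^k)|<\varepsilon$ for all $i=0,1,\dots,q-1$. (b) If instead $z^k$ is attracting and $z^{k+1}$ is repelling within $(z^k,z^{k+1})$, then there exists $\widetilde z_k\in(z^k,z^{k+1})$ such that, with $B_k^+:=(z^k,\widetilde z_k]$ and $B_k^-:=[\widetilde z_k,z^{k+1})$, the statements 1) and 2) hold with the roles of $z^k$ and $z^{k+1}$ interchanged. (c) The same holds if there is only one periodic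 point, i.e. a fixed point $z_0$ (with the interval $S^1\setminus\{z_0\}$, both of whose ends are $z_0$, in place of $(z^k,z^{k+1})$); in that case, with $\widetilde z_0$, $B_0^+$, $B_0^-$ the corresponding objects, $S^1\setminus\{z_0\}=B_0^+\cup B_0^-$ and $B_0^+\cap B_0^-=\{\widetilde z_0\}$.
   Context: $S^1$ is the unit circle, intervals on $S^1$ are arcs ordered by the positive orientation. For a lift $\Phi:\mathbb{R}\to\mathbb{R}$ of $\varphi$, the rotation number is $\varrho(\varphi)=\lim_{n}\Phi^n(x)/n\bmod 1$; if $\varrho(\varphi)=p/q$ in lowest terms, all periodic points have period $q$. Between two consecutive periodic points $z^k,z^{k+1}$, every point of the open arc is asymptotic under $\varphi^q$ (forward) to one of the two end-points, called attracting within the interval, and under $\varphi^{-q}$ (backward) to the other one, called repelling within the interval. Distances: for each $j\in\mathbb{Z}$ the map $\varphi^j$ maps $[z^k,z^{k+1}]$ onto the arc $[\varphi^j(z^k),\varphi^j(z^{k+1})]$; for $z\in(z^k,z^{k+1})$ the quantity $|\varphi^j(z)-\varphi^j(z^k)|$ (respectively $|\varphi^j(z)-\varphi^j(z^{k+1})|$) denotes the length of the sub-arc of this arc between $\varphi^j(z)$ and the end-point $\varphi^j(z^k)$ (respectively $\varphi^j(z^{k+1})$). Since $z^k,z^{k+1}$ are $q$-periodic, $\varphi^{q-i}(z^k)=\varphi^{-nq-i}(z^k)$ and $\varphi^{i}(z^{k+1})=\varphi^{nq+i}(z^{k+1})$. In the case of a single fixed point the arc is the whole circle cut at $z_0$,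 with the two ends treated as distinct. *)

theory Defs
  imports "HOL-Analysis.Analysis"
begin

abbreviation unit_circle :: "complex set"
  where "unit_circle \<equiv> sphere 0 1"

definition is_lift :: "(real \<Rightarrow> real) \<Rightarrow> (complex \<Rightarrow> complex) \<Rightarrow> bool"
  where "is_lift \<Phi> \<phi> \<longleftrightarrow>
    continuous_on UNIV \<Phi> \<and> (\<forall>x. \<phi> (cis (2 * pi * x)) = cis (2 * pi * \<Phi> x))"

definition orientation_preserving_circle_homeo :: "(complex \<Rightarrow> complex) \<Rightarrow> bool"
  where "orientation_preserving_circle_homeo \<phi> \<longleftrightarrow>
    (\<exists>\<psi>. homeomorphism unit_circle unit_circle \<phi> \<psi>) \<and> (\<exists>\<Phi>. is_lift \<Phi> \<phi> \<and> strict_mono \<Phi>)"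

text \<open>The class modulo 1 of the limit is represented by its element of \<open>[0, 1)\<close>. The limit is
  required to exist, with the same class, for all lifts and all starting points.\<close>

definition rotation_number :: "(complex \<Rightarrow> complex) \<Rightarrow> real"
  where "rotation_number \<phi> = (THE \<rho>. 0 \<le> \<rho> \<and> \<rho> < 1 \<and>
    (\<forall>\<Phi> x. is_lift \<Phi> \<phi> \<longrightarrow>
      (\<exists>L. (\<lambda>n. (\<Phi> ^^ n) x / real n) \<longlonglongrightarrow> L \<and> frac L = \<rho>)))"

definition circle_iterate :: "(complex \<Rightarrow> complex) \<Rightarrow> int \<Rightarrow> complex \<Rightarrow> complex"
  where "circle_iterate \<phi> j =
    (if 0 \<le> j then \<phi> ^^ nat j else inv_into unit_circle \<phi> ^^ nat (- j))"

definition periodic_points :: "(complex \<Rightarrow> complex) \<Rightarrow> complex set"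
  where "periodic_points \<phi> = {z \<in> unit_circle. \<exists>m>0. (\<phi> ^^ m) z = z}"

text \<open>Length of the arc that runs from \<open>a\<close> to \<open>b\<close> in the positive direction, for points of the
  unit circle. It lies in \<open>[0, 2 * pi)\<close> and is not symmetric in \<open>a\<close> and \<open>b\<close>.\<close>

definition arc_length :: "complex \<Rightarrow> complex \<Rightarrow> real"
  where "arc_length a b = Arg2pi (b / a)"

text \<open>The positively oriented arcs \<open>(a, b)\<close>, \<open>(a, b]\<close> and \<open>[a, b)\<close>, for distinct end-points
  \<open>a\<close> and \<open>b\<close>.\<close>

definition arc_oo :: "complex \<Rightarrow> complex \<Rightarrow> complex set"
  where "arc_oo a b = {z \<in> unit_circle. 0 < arc_length a z \<and> arc_length a z < arc_length a b}"

definition arc_oc :: "complex \<Rightarrow> complex \<Rightarrow> complex set"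
  where "arc_oc a b = {z \<in> unit_circle. 0 < arc_length a z \<and> arc_length a z \<le> arc_length a b}"

definition arc_co :: "complex \<Rightarrow> complex \<Rightarrow> complex set"
  where "arc_co a b = {z \<in> unit_circle. arc_length a z < arc_length a b}"

definition consecutive_periodic_points :: "(complex \<Rightarrow> complex) \<Rightarrow> complex \<Rightarrow> complex \<Rightarrow> bool"
  where "consecutive_periodic_points \<phi> a b \<longleftrightarrow>
    a \<in> periodic_points \<phi> \<and> b \<in> periodic_points \<phi> \<and> a \<noteq> b \<and> arc_oo a b \<inter> periodic_points \<phi> = {}"

text \<open>Distance of a point \<open>z\<close> of an arc to the left (initial) and to the right (final) end-point
  \<open>e\<close> of that arc, measured inside the arc. For an arc that is the whole circle cut at one point
  these two functions distinguish the two ends. In the definitions below, the argument \<open>d\<close> is one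
  of them and so tells at which end of the arc the end-point \<open>e\<close> lies.\<close>

definition dist_left_end :: "complex \<Rightarrow> complex \<Rightarrow> real"
  where "dist_left_end e z = arc_length e z"

definition dist_right_end :: "complex \<Rightarrow> complex \<Rightarrow> real"
  where "dist_right_end e z = arc_length z e"

definition attracting_within ::
    "(complex \<Rightarrow> complex) \<Rightarrow> nat \<Rightarrow> complex set \<Rightarrow> (complex \<Rightarrow> complex \<Rightarrow> real) \<Rightarrow> complex \<Rightarrow> bool"
  where "attracting_within \<phi> q I d e \<longleftrightarrow>
    (\<forall>z\<in>I. (\<lambda>n. d e (circle_iterate \<phi> (int (n * q)) z)) \<longlonglongrightarrow> 0)"

definition repelling_within ::
    "(complex \<Rightarrow> complex) \<Rightarrow> nat \<Rightarrow> complex set \<Rightarrow> (complex \<Rightarrow> complex \<Rightarrow> real) \<Rightarrow> complex \<Rightarrow> bool"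
  where "repelling_within \<phi> q I d e \<longleftrightarrow>
    (\<forall>z\<in>I. (\<lambda>n. d e (circle_iterate \<phi> (- int (n * q)) z)) \<longlonglongrightarrow> 0)"

definition forward_close ::
    "(complex \<Rightarrow> complex) \<Rightarrow> nat \<Rightarrow> real \<Rightarrow> (complex \<Rightarrow> complex \<Rightarrow> real) \<Rightarrow> complex \<Rightarrow> nat \<Rightarrow> complex \<Rightarrow> bool"
  where "forward_close \<phi> q \<epsilon> d e n z \<longleftrightarrow>
    (\<forall>i<q. d (circle_iterate \<phi> (int i) e) (circle_iterate \<phi> (int (n * q) + int i) z) < \<epsilon>)"

definition backward_close ::
    "(complex \<Rightarrow> complex) \<Rightarrow> nat \<Rightarrow> real \<Rightarrow> (complex \<Rightarrow> complex \<Rightarrow> real) \<Rightarrow> complex \<Rightarrow> nat \<Rightarrow> complex \<Rightarrow> bool"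
  where "backward_close \<phi> q \<epsilon> d e n z \<longleftrightarrow>
    (\<forall>i<q. d (circle_iterate \<phi> (int q - int i) e) (circle_iterate \<phi> (- int (n * q) - int i) z) < \<epsilon>)"

end

theory Submission
  imports Defs
begin

text \<open>
  The angle is unrolled: the arc becomes an interval \<open>(l, r)\<close> of reals with \<open>r \<le> l + 1\<close>, where one
  unit is a full turn; the circle cut at a single point is the case \<open>r = l + 1\<close>. Let \<open>f\<close> be the map
  or its inverse, whichever attracts towards the end \<open>r\<close>, and let \<open>T\<close> be the lift of \<open>f^q\<close> that
  fixes \<open>l\<close>. As \<open>f^q\<close> fixes both ends (the limit of an orbit of a continuous map is a fixed point),
  \<open>T\<close> fixes \<open>r\<close> too. So \<open>T\<close> moves all points of \<open>(l, r)\<close> to the right, and its inverse \<open>R\<close> moves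
  them to the left.

  The distance from \<open>f^i(z)\<close> to the end \<open>f^i(r)\<close> decreases as \<open>z\<close> moves to the right. Being
  \<open>\<epsilon>\<close>-close to \<open>r\<close> during \<open>q\<close> steps from time \<open>n * q\<close> on is therefore a condition
  \<open>u < T^n x\<close>, and being \<open>\<epsilon>\<close>-close to \<open>l\<close> during \<open>q\<close> steps of the reversed motion is a condition \<open>R^n x < d\<close>, with
  thresholds \<open>u < r\<close> and \<open>l < d\<close> that do not depend on \<open>n\<close>. The first condition persists to the right
  and the second one to the left. Hence both required implications hold as soon as the cut point
  \<open>c\<close> is balanced: for every \<open>n\<close>, it satisfies the first condition at time \<open>n\<close> if and only if it
  satisfies the second one at time \<open>n\<close>.

  A balanced point exists by \<open>balanced_point\<close>. Rewrite the conditions as \<open>R^n u < c\<close> and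
  \<open>c < T^n d\<close>. If \<open>u < d\<close>, any point of the interval between \<open>u\<close> and \<open>d\<close> satisfies both at all
  times. Otherwise
  \<open>R^n u\<close> decreases and \<open>T^n d\<close> increases, and they cross at some first time \<open>N \<ge> 1\<close>. From time
  \<open>N\<close> on, both conditions hold on \<open>(R^N u, T^N d)\<close>; at all earlier times both fail on
  \<open>[T^(N-1) d, R^(N-1) u]\<close>. These two intervals have a common point, and it is balanced.

  The theorem follows from \<open>exists_balanced_circle_point\<close>, where the above is carried out for a
  map with a degree one lift and its inverse. The two orientations of the dynamics on the arc are
  the two choices of which of \<open>\<phi>\<close> and its inverse plays the part of \<open>f\<close>.
\<close>

section \<open>Balanced points of an increasing bijection of an interval\<close>

text \<open>As \<open>n\<close> grows, both conditions on a fixed \<open>c\<close> get weaker. The right \<open>c\<close> is one for which they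
  become true at the same time, and this is possible at the first time when some point of the
  interval satisfies both.\<close>

lemma balanced_point:
  fixes T R :: "real \<Rightarrow> real"
  assumes T: "strict_mono T" and R: "strict_mono R"
    and TR: "\<And>x. T (R x) = x" and RT: "\<And>x. R (T x) = x"
    and l: "T l = l" and r: "T r = r" and lr: "l < r"
    and attr: "\<And>x. \<lbrakk>l < x; x < r\<rbrakk> \<Longrightarrow> (\<lambda>n. (T ^^ n) x) \<longlonglongrightarrow> r"
    and rep: "\<And>x. \<lbrakk>l < x; x < r\<rbrakk> \<Longrightarrow> (\<lambda>n. (R ^^ n) x) \<longlonglongrightarrow> l"
    and u: "u < r" and d: "l < d"
  shows "\<exists>c. l < c \<and> c < r \<and> (\<forall>n. u < (T ^^ n) c \<longleftrightarrow> (R ^^ n) c < d)"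
proof -
  have Tn: "strict_mono (T ^^ n)" and Rn: "strict_mono (R ^^ n)" for n
    by (induction n) (use T R in \<open>auto simp: strict_mono_def\<close>)
  have TRn: "(T ^^ n) ((R ^^ n) x) = x" and RTn: "(R ^^ n) ((T ^^ n) x) = x" for n x
    by (induction n arbitrary: x) (simp_all add: TR RT funpow_swap1)
  have up_iff: "u < (T ^^ n) c \<longleftrightarrow> (R ^^ n) u < c" for n c
    using strict_mono_less[OF Rn, of n u "(T ^^ n) c"] by (simp add: RTn)
  have down_iff: "(R ^^ n) c < d \<longleftrightarrow> c < (T ^^ n) d" for n c
    using strict_mono_less[OF Tn, of n "(R ^^ n) c" d] by (simp add: TRn)
  have R_in: "l < R x \<and> R x < r" if "l < x" "x < r" for x
    using that strict_monoD[OF R] RT l r by metis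
  have T_in: "l < T x \<and> T x < r" if "l < x" "x < r" for x
    using that strict_monoD[OF T] l r by metis
  have T_up: "x < T x" if x: "l < x" "x < r" for x
  proof (rule ccontr)
    assume "\<not> x < T x"
    then have "(T ^^ n) x \<le> x" for n
      by (induction n) (auto intro: order_trans strict_mono_leD[OF T])
    then have "r \<le> x" using attr[OF x] by (intro LIMSEQ_le_const2) auto
    then show False using x by simp
  qed
  have R_down: "R x < x" if "l < x" "x < r" for x
    using T_up[of "R x"] R_in[OF that] TR by simp
  have Tn_in: "l < (T ^^ n) x \<and> (T ^^ n) x < r" and Rn_in: "l < (R ^^ n) x \<and> (R ^^ n) x < r"
    if "l < x" "x < r" for n x
    by (induction n) (use that T_in R_in in auto)
  have inc: "(T ^^ m) x \<le> (T ^^ n) x" and dec: "(R ^^ n) x \<le> (R ^^ m) x"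
    if "l < x" "x < r" "m \<le> n" for m n x
  proof -
    have "(T ^^ n) x \<le> (T ^^ Suc n) x" "(R ^^ Suc n) x \<le> (R ^^ n) x" for n
      using that T_up[of "(T ^^ n) x"] R_down[of "(R ^^ n) x"] Tn_in Rn_in by (auto intro: less_imp_le)
    then show "(T ^^ m) x \<le> (T ^^ n) x" "(R ^^ n) x \<le> (R ^^ m) x"
      using lift_Suc_mono_le[of "\<lambda>n. (T ^^ n) x"] lift_Suc_antimono_le[of "\<lambda>n. (R ^^ n) x"] that(3)
      by blast+
  qed
  show ?thesis
  proof (cases "u < d")
    case True
    then obtain c where c: "max u l < c" "c < min d r"
      using lr u d dense[of "max u l" "min d r"] by auto
    have "u < (T ^^ n) c \<and> (R ^^ n) c < d" for n
      using inc[of c 0 n] dec[of c 0 n] c by auto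
    then show ?thesis using c by auto
  next
    case False
    then have ud: "l < d" "d < r" "l < u" "u < r" using u d by auto
    obtain m where m: "l < m" "m < r" using lr dense by blast
    have "eventually (\<lambda>n. (R ^^ n) u < m \<and> m < (T ^^ n) d) sequentially"
      using order_tendstoD(2)[OF rep[of u] m(1)] order_tendstoD(1)[OF attr[of d] m(2)] ud
      by (simp add: eventually_conj)
    then obtain K where "(R ^^ K) u < (T ^^ K) d"
      unfolding eventually_sequentially by (meson le_refl less_trans)
    then obtain N where N: "(R ^^ N) u < (T ^^ N) d"
        and least: "\<And>n. n < N \<Longrightarrow> \<not> (R ^^ n) u < (T ^^ n) d"
      using exists_least_iff[of "\<lambda>n. (R ^^ n) u < (T ^^ n) d"] by blast
    obtain M where M: "N = Suc M" using N False by (cases N) auto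
    \<comment> \<open>Both conditions hold at time \<open>N\<close> on \<open>(A, B)\<close> and both fail at time \<open>M\<close> on \<open>[C, E]\<close>. The
      strict inequalities \<open>A < E\<close> and \<open>C < B\<close> make the two intervals meet: at \<open>C\<close> if \<open>A < C\<close>,
      and just to the right of \<open>A\<close> otherwise.\<close>
    define A B C E where "A = (R ^^ N) u" and "B = (T ^^ N) d"
      and "C = (T ^^ M) d" and "E = (R ^^ M) u"
    have "A < B" using N by (simp add: A_def B_def)
    moreover have "C \<le> E" using least[of M] M by (simp add: C_def E_def)
    moreover have "A < E" using R_down Rn_in ud by (simp add: A_def E_def M)
    moreover have "C < B" using T_up Tn_in ud by (simp add: B_def C_def M)
    ultimately obtain c where c: "A < c" "c < B" "C \<le> c" "c \<le> E"
      using dense[of A "min B E"] by (cases "A < C") auto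
    have "u < (T ^^ n) c \<longleftrightarrow> (R ^^ n) c < d" for n
    proof (cases "N \<le> n")
      case True
      then show ?thesis
        using inc[of d N n] dec[of u N n] ud c unfolding up_iff down_iff A_def B_def by auto
    next
      case False
      then have "n \<le> M" using M by simp
      then show ?thesis
        using inc[of d n M] dec[of u n M] ud c unfolding up_iff down_iff C_def E_def by auto
    qed
    moreover have "l < c" "c < r"
      using c Tn_in[of d N] Rn_in[of u N] ud by (auto simp: A_def B_def)
    ultimately show ?thesis by blast
  qed
qed

section \<open>Arcs of the circle in an angular coordinate\<close>

abbreviation circle_point :: "real \<Rightarrow> complex"
  where "circle_point t \<equiv> cis (2 * pi * t)"

lemma circle_point_eq_iff: "circle_point x = circle_point y \<longleftrightarrow> x - y \<in> \<int>"
proof -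
  have "circle_point x = circle_point y \<longleftrightarrow> circle_point (x - y) = 1"
    by (simp add: right_diff_distrib flip: cis_divide)
  also have "\<dots> \<longleftrightarrow> x - y \<in> \<int>"
    by (auto simp: complex_eq_iff cos_one_2pi_int sin_times_pi_eq_0 Ints_def)
  finally show ?thesis .
qed

lemma arc_length_circle_point: "arc_length (circle_point x) (circle_point y) = 2 * pi * frac (y - x)"
  unfolding arc_length_def
proof (rule Arg2pi_unique[of 1])
  have "circle_point (frac (y - x)) = circle_point (y - x)"
    by (simp add: circle_point_eq_iff frac_def)
  then show "of_real 1 * exp (\<i> * of_real (2 * pi * frac (y - x))) = circle_point y / circle_point x"
    by (metis cis_conv_exp cis_divide mult_1 of_real_1 right_diff_distrib)
qed (auto simp: frac_lt_1)

text \<open>Below a full turn, distances inside an arc become differences of reals; at \<open>y = x + 1\<close> the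
  length jumps back to \<open>0\<close>.\<close>

lemma arc_length_circle_point_less:
  assumes "x \<le> y" "y < x + 1"
  shows "arc_length (circle_point x) (circle_point y) = 2 * pi * (y - x)"
  using assms by (simp add: arc_length_circle_point frac_eq)

lemma unit_circle_eq: "unit_circle = circle_point ` {s..<s + 1}"
proof (intro set_eqI iffI)
  fix z assume "z \<in> unit_circle"
  then obtain x where x: "z = cis x"
    by (metis cis_Arg norm_eq_zero dist_0_norm mem_sphere zero_neq_one sgn_eq div_by_1 of_real_1)
  then have "z = circle_point (s + frac (x / (2 * pi) - s))"
    by (simp add: frac_def circle_point_eq_iff[of "x / (2 * pi)", simplified])
  then show "z \<in> circle_point ` {s..<s + 1}" by (auto simp: frac_lt_1)
qed auto

lemma circle_point_eq_of_arc_length: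
  assumes "w \<in> unit_circle"
  shows "w = circle_point (e + arc_length (circle_point e) w / (2 * pi))"
    and "w = circle_point (e - arc_length w (circle_point e) / (2 * pi))"
proof -
  obtain y where y: "w = circle_point y" using assms by (auto simp: unit_circle_eq[of 0])
  show "w = circle_point (e + arc_length (circle_point e) w / (2 * pi))"
    by (simp add: y arc_length_circle_point circle_point_eq_iff frac_def)
  show "w = circle_point (e - arc_length w (circle_point e) / (2 * pi))"
    by (simp add: y arc_length_circle_point circle_point_eq_iff frac_def)
qed

lemma arc_oo_circle_point:
  assumes "l < r" "r < l + 1"
  shows "arc_oo (circle_point l) (circle_point r) = circle_point ` {l<..<r}"
  unfolding arc_oo_def unit_circle_eq[of l]
  using assms by (auto simp: arc_length_circle_point_less zero_less_mult_iff)

lemma arc_oc_circle_point: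
  assumes "l < r" "r < l + 1"
  shows "arc_oc (circle_point l) (circle_point r) = circle_point ` {l<..r}"
  unfolding arc_oc_def unit_circle_eq[of l]
  using assms by (auto simp: arc_length_circle_point_less zero_less_mult_iff)

lemma arc_co_circle_point:
  assumes "l < r" "r < l + 1"
  shows "arc_co (circle_point l) (circle_point r) = circle_point ` {l..<r}"
  unfolding arc_co_def unit_circle_eq[of l]
  using assms by (auto simp: arc_length_circle_point_less)

lemma inj_on_circle_point: "inj_on circle_point {s..<s + 1}"
proof (rule inj_onI)
  fix x y assume "x \<in> {s..<s + 1}" "y \<in> {s..<s + 1}" "circle_point x = circle_point y"
  then have "x - y \<in> \<int>" "\<bar>x - y\<bar> < 1" by (auto simp: circle_point_eq_iff)
  then show "x = y" using Ints_nonzero_abs_less1[of "x - y"] by auto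
qed

lemma punctured_circle_eq: "unit_circle - {circle_point l} = circle_point ` {l<..<l + 1}"
proof -
  have "unit_circle - {circle_point l} = circle_point ` ({l..<l + 1} - {l})"
    unfolding unit_circle_eq[of l] by (subst inj_on_image_set_diff[OF inj_on_circle_point[of l]]) auto
  also have "{l..<l + 1} - {l} = {l<..<l + 1}" by auto
  finally show ?thesis .
qed

lemma punctured_circle_cut:
  assumes "z0 \<in> unit_circle" "c \<in> unit_circle - {z0}"
  shows "unit_circle - {z0} = arc_co c z0 \<union> arc_oc z0 c" "arc_co c z0 \<inter> arc_oc z0 c = {c}"
proof -
  obtain l where l: "z0 = circle_point l" using assms by (auto simp: unit_circle_eq[of 0])
  then obtain s where s: "l < s" "s < l + 1" "c = circle_point s"
    using assms punctured_circle_eq[of l] by auto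
  have "z0 = circle_point (l + 1)" by (simp add: l circle_point_eq_iff)
  then have co: "arc_co c z0 = circle_point ` {s..<l + 1}"
    using s by (simp add: arc_co_circle_point)
  have oc: "arc_oc z0 c = circle_point ` {l<..s}"
    using s by (simp add: l arc_oc_circle_point)
  have "{l<..<l + 1} = {s..<l + 1} \<union> {l<..s}" using s by auto
  then show "unit_circle - {z0} = arc_co c z0 \<union> arc_oc z0 c"
    by (simp add: l[symmetric] co oc punctured_circle_eq[of l, folded l] image_Un)
  have "circle_point ` {s..<l + 1} \<inter> circle_point ` {l<..s} = circle_point ` ({s..<l + 1} \<inter> {l<..s})"
    using s by (intro inj_on_image_Int[OF inj_on_circle_point[of l], symmetric]) auto
  also have "{s..<l + 1} \<inter> {l<..s} = {s}" using s by auto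
  finally show "arc_co c z0 \<inter> arc_oc z0 c = {c}" unfolding co oc by (simp add: s(3))
qed

section \<open>Lifts of orientation preserving circle maps\<close>

text \<open>These are the lifts of orientation preserving homeomorphisms. Continuity follows from
  monotonicity and surjectivity; in this form the notion passes to inverses and iterates by
  elementary arguments.\<close>

definition degree_one_lift :: "(real \<Rightarrow> real) \<Rightarrow> (complex \<Rightarrow> complex) \<Rightarrow> bool"
  where "degree_one_lift F f \<longleftrightarrow> strict_mono F \<and> surj F \<and> (\<forall>t. F (t + 1) = F t + 1) \<and>
    (\<forall>t. f (circle_point t) = circle_point (F t))"

lemma degree_one_liftD:
  assumes "degree_one_lift F f"
  shows "strict_mono F" "surj F" "F (t + 1) = F t + 1" "f (circle_point t) = circle_point (F t)"
  using assms by (auto simp: degree_one_lift_def)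

lemma degree_one_lift_funpow:
  assumes "degree_one_lift F f"
  shows "degree_one_lift (F ^^ n) (f ^^ n)"
proof (induction n)
  case (Suc n)
  then have "surj (F \<circ> (F ^^ n))"
    using assms by (intro comp_surj) (auto simp: degree_one_lift_def)
  then show ?case
    using Suc assms by (auto simp: degree_one_lift_def strict_mono_def comp_def)
qed (auto simp: degree_one_lift_def strict_mono_def)

lemma degree_one_lift_inv:
  assumes F: "degree_one_lift F f" and h: "\<And>z. z \<in> unit_circle \<Longrightarrow> h (f z) = z"
  shows "degree_one_lift (inv F) h"
proof -
  have bij: "bij F" using F by (auto simp: degree_one_lift_def bij_def strict_mono_imp_inj_on)
  have F_inv: "F (inv F t) = t" for t using bij by (simp add: bij_inv_eq_iff[symmetric])
  have "strict_mono (inv F)"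
    using strict_mono_inv[OF degree_one_liftD(1,2)[OF F]] bij by (simp add: bij_is_inj)
  moreover have "surj (inv F)" using bij by (simp add: bij_imp_bij_inv bij_is_surj)
  moreover have "inv F (t + 1) = inv F t + 1" for t
    using bij degree_one_liftD(3)[OF F, of "inv F t"] by (simp add: F_inv inv_f_eq bij_is_inj)
  moreover have "h (circle_point t) = circle_point (inv F t)" for t
    using h[of "circle_point (inv F t)"] by (simp add: degree_one_liftD(4)[OF F] F_inv)
  ultimately show ?thesis by (simp add: degree_one_lift_def)
qed

lemma degree_one_lift_diff_int:
  assumes "degree_one_lift F f"
  shows "degree_one_lift (\<lambda>t. F t - of_int k) f"
proof -
  have "surj (\<lambda>t. F t - of_int k)"
  proof (rule surjI)
    show "F (inv F (y + of_int k)) - of_int k = y" for y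
      using assms by (simp add: degree_one_lift_def surj_f_inv_f)
  qed
  then show ?thesis
    using assms by (auto simp: degree_one_lift_def strict_mono_def circle_point_eq_iff)
qed

lemma isCont_degree_one_lift:
  assumes "degree_one_lift F f"
  shows "isCont F x"
proof -
  have "continuous_on UNIV F"
    using degree_one_liftD[OF assms] by (intro continuous_onI_mono) (auto simp: strict_mono_less_eq)
  then show ?thesis by (simp add: continuous_on_eq_continuous_at)
qed

lemma degree_one_lift_shift_nat:
  assumes "\<And>t. F (t + 1) = F t + (1::real)"
  shows "F (t + real n) = F t + real n"
proof (induction n)
  case (Suc n)
  then show ?case using assms[of "t + real n"] by (simp add: algebra_simps)
qed simp

text \<open>The increment \<open>F (t + 1) - F t\<close> is a positive integer. If it were larger than one, \<open>F\<close> would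
  take the value \<open>F t + 1\<close> strictly between \<open>t\<close> and \<open>t + 1\<close>, against the injectivity of \<open>\<phi>\<close>.\<close>

lemma obtain_degree_one_lift:
  assumes "orientation_preserving_circle_homeo \<phi>"
  obtains F where "degree_one_lift F \<phi>"
proof -
  from assms obtain \<psi> F where hom: "homeomorphism unit_circle unit_circle \<phi> \<psi>"
    and cont: "continuous_on UNIV F" and lift: "\<And>t. \<phi> (circle_point t) = circle_point (F t)"
    and mono: "strict_mono F"
    by (auto simp: orientation_preserving_circle_homeo_def is_lift_def)
  have inj: "inj_on \<phi> unit_circle" using hom by (metis homeomorphism_apply1 inj_on_inverseI)
  have deg: "F (t + 1) = F t + 1" for t
  proof -
    have "circle_point (F (t + 1)) = circle_point (F t)"
      using lift[of "t + 1"] lift[of t] circle_point_eq_iff[of "t + 1" t] by simp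
    then have int: "F (t + 1) - F t \<in> \<int>" by (simp add: circle_point_eq_iff)
    have less: "F t < F (t + 1)" using mono by (simp add: strict_mono_def)
    have "\<not> F t + 1 < F (t + 1)"
    proof
      assume "F t + 1 < F (t + 1)"
      then obtain y where y: "t \<le> y" "y \<le> t + 1" "F y = F t + 1"
        using IVT'[of F t "F t + 1" "t + 1"] continuous_on_subset[OF cont] by force
      then have "\<phi> (circle_point y) = \<phi> (circle_point t)"
        by (simp add: lift circle_point_eq_iff)
      then have "circle_point y = circle_point t" using inj by (simp add: inj_on_def)
      then have "y - t \<in> \<int>" by (simp add: circle_point_eq_iff)
      moreover have "y \<noteq> t" "y \<noteq> t + 1" using y \<open>F t + 1 < F (t + 1)\<close> by auto
      ultimately show False using y Ints_nonzero_abs_less1[of "y - t"] by auto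
    qed
    moreover obtain k where "F (t + 1) - F t = of_int k" using int by (auto elim: Ints_cases)
    moreover from this have "0 < k" using less by (simp flip: of_int_0_less_iff)
    ultimately show ?thesis by auto
  qed
  have "\<exists>x. F x = y" for y
  proof -
    obtain n where n: "\<bar>y - F 0\<bar> \<le> real n" using real_arch_simple by blast
    have "F (- real n) \<le> y" "y \<le> F (real n)"
      using degree_one_lift_shift_nat[of F 0 n, OF deg]
        degree_one_lift_shift_nat[of F "- real n" n, OF deg] n by auto
    then show ?thesis
      using IVT'[of F "- real n" y "real n"] continuous_on_subset[OF cont] by force
  qed
  then have "surj F" unfolding surj_def by metis
  then show ?thesis using that mono deg lift by (auto simp: degree_one_lift_def)
qed

lemma funpow_in_unit_circle:
  assumes "degree_one_lift F f" "z \<in> unit_circle"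
  shows "(f ^^ n) z \<in> unit_circle"
proof -
  obtain t where "z = circle_point t" using assms(2) by (auto simp: unit_circle_eq[of 0])
  then show ?thesis by (simp add: degree_one_liftD(4)[OF degree_one_lift_funpow[OF assms(1)]])
qed

lemma funpow_left_inverse:
  assumes F: "degree_one_lift F f" and h: "\<And>z. z \<in> unit_circle \<Longrightarrow> h (f z) = z"
    and z: "z \<in> unit_circle"
  shows "(h ^^ n) ((f ^^ n) z) = z"
  proof (induction n)
  case (Suc n)
  then show ?case
    using h[OF funpow_in_unit_circle[OF F z, of n]] by (simp add: funpow_swap1)
qed simp

section \<open>Ends of an arc as limits of orbits\<close>

lemma limit_of_orbit_fixed:
  assumes P: "degree_one_lift P p" and orbit: "\<And>n. (p ^^ n) z = circle_point (x n)"
    and lim: "x \<longlonglongrightarrow> e"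
  shows "p (circle_point e) = circle_point e"
proof -
  have cont: "isCont circle_point t" for t
    by (simp add: cis_conv_exp)
  have "(\<lambda>n. circle_point (P (x n))) \<longlonglongrightarrow> circle_point (P e)"
    by (intro isCont_tendsto_compose[OF cont] isCont_tendsto_compose[OF isCont_degree_one_lift[OF P]] lim)
  moreover have "circle_point (P (x n)) = circle_point (x (Suc n))" for n
    using orbit[of n] orbit[of "Suc n"] degree_one_liftD(4)[OF P] by simp
  ultimately have "(\<lambda>n. circle_point (x (Suc n))) \<longlonglongrightarrow> circle_point (P e)" by simp
  moreover have "(\<lambda>n. circle_point (x (Suc n))) \<longlonglongrightarrow> circle_point e"
    by (intro isCont_tendsto_compose[OF cont] LIMSEQ_Suc lim)
  ultimately show ?thesis using LIMSEQ_unique degree_one_liftD(4)[OF P] by metis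
qed

text \<open>If the distance within an arc from the orbit of \<open>z\<close> under \<open>f^q\<close> to \<open>e\<close> tends to \<open>0\<close>, then the
  orbit converges to \<open>e\<close> on the circle, from whichever side, and continuity of \<open>f^q\<close> applies.\<close>

lemma attracting_end_fixed:
  assumes F: "degree_one_lift F f" and z: "z \<in> unit_circle" and e: "e \<in> unit_circle"
    and d: "d = dist_right_end \<or> d = dist_left_end"
    and lim: "(\<lambda>n. d e ((f ^^ (n * q)) z)) \<longlonglongrightarrow> 0"
  shows "(f ^^ q) e = e"
proof -
  obtain t where t: "e = circle_point t" using e by (auto simp: unit_circle_eq[of 0])
  define \<delta> where "\<delta> n = d e ((f ^^ (n * q)) z) / (2 * pi)" for n
  have \<delta>: "\<delta> \<longlonglongrightarrow> 0" unfolding \<delta>_def using tendsto_divide[OF lim tendsto_const, of "2 * pi"] by simp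
  have in_circle: "((f ^^ q) ^^ n) z \<in> unit_circle" for n
    by (intro funpow_in_unit_circle[OF degree_one_lift_funpow[OF F]] z)
  note param = circle_point_eq_of_arc_length[OF in_circle, of _ t]
  have "\<exists>x. (\<forall>n. ((f ^^ q) ^^ n) z = circle_point (x n)) \<and> x \<longlonglongrightarrow> t"
    using d
  proof
    assume "d = dist_right_end"
    then have "((f ^^ q) ^^ n) z = circle_point (t - \<delta> n)" for n
      using param(2)[of n] by (simp add: \<delta>_def t dist_right_end_def funpow_mult mult.commute)
    moreover have "(\<lambda>n. t - \<delta> n) \<longlonglongrightarrow> t" using tendsto_diff[OF tendsto_const \<delta>, of t] by simp
    ultimately show ?thesis by (intro exI[of _ "\<lambda>n. t - \<delta> n"]) simp
  next
    assume "d = dist_left_end"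
    then have "((f ^^ q) ^^ n) z = circle_point (t + \<delta> n)" for n
      using param(1)[of n] by (simp add: \<delta>_def t dist_left_end_def funpow_mult mult.commute)
    moreover have "(\<lambda>n. t + \<delta> n) \<longlonglongrightarrow> t" using tendsto_add[OF tendsto_const \<delta>, of t] by simp
    ultimately show ?thesis by (intro exI[of _ "\<lambda>n. t + \<delta> n"]) simp
  qed
  then obtain x where "\<And>n. ((f ^^ q) ^^ n) z = circle_point (x n)" "x \<longlonglongrightarrow> t" by blast
  then show ?thesis
    unfolding t by (rule limit_of_orbit_fixed[OF degree_one_lift_funpow[OF F]])
qed

section \<open>Closeness to an end of an arc during several steps\<close>

text \<open>Common form of forward and backward closeness: the former is the case of the map itself, the
  latter that of its inverse when its \<open>q\<close>-th iterate fixes \<open>e\<close>.\<close>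

definition orbit_close ::
    "(complex \<Rightarrow> complex) \<Rightarrow> nat \<Rightarrow> real \<Rightarrow> (complex \<Rightarrow> complex \<Rightarrow> real) \<Rightarrow> complex \<Rightarrow> nat \<Rightarrow> complex \<Rightarrow> bool"
  where "orbit_close f q \<epsilon> d e n z \<longleftrightarrow> (\<forall>i<q. d ((f ^^ i) e) ((f ^^ (n * q + i)) z) < \<epsilon>)"

lemma funpow_mult_add: "f ^^ (n * q + i) = (f ^^ i) \<circ> ((f ^^ q) ^^ n)"
proof -
  have "f ^^ (n * q + i) = f ^^ (i + q * n)" by (simp add: algebra_simps)
  then show ?thesis by (simp only: funpow_add funpow_mult)
qed

text \<open>Each of the finitely many conditions cuts off a right half-line, since \<open>F i\<close> is an increasing
  bijection; the threshold is the largest of the \<open>q\<close> left ends. The lemma after it is the mirror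
  image.\<close>

lemma near_right_threshold:
  fixes F :: "nat \<Rightarrow> real \<Rightarrow> real"
  assumes F: "\<And>i. strict_mono (F i)" "\<And>i. surj (F i)" and "0 < q" "0 < \<delta>"
  shows "\<exists>u<r. \<forall>x. (\<forall>i<q. F i r - F i x < \<delta>) \<longleftrightarrow> u < x"
proof -
  define u where "u i = inv (F i) (F i r - \<delta>)" for i
  have Fu: "F i (u i) = F i r - \<delta>" for i using F by (simp add: u_def surj_f_inv_f)
  have "F i r - F i x < \<delta> \<longleftrightarrow> u i < x" for i x
    using strict_mono_less[OF F(1), of i "u i" x] by (auto simp: Fu)
  moreover have "u i < r" for i
    using strict_mono_less[OF F(1), of i "u i" r] \<open>0 < \<delta>\<close> by (auto simp: Fu)
  ultimately show ?thesis
    using \<open>0 < q\<close> by (intro exI[of _ "Max (u ` {..<q})"]) (auto simp: lessThan_empty_iff)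
qed

lemma near_left_threshold:
  fixes F :: "nat \<Rightarrow> real \<Rightarrow> real"
  assumes F: "\<And>i. strict_mono (F i)" "\<And>i. surj (F i)" and "0 < q" "0 < \<delta>"
  shows "\<exists>u>l. \<forall>x. (\<forall>i<q. F i x - F i l < \<delta>) \<longleftrightarrow> x < u"
proof -
  define u where "u i = inv (F i) (F i l + \<delta>)" for i
  have Fu: "F i (u i) = F i l + \<delta>" for i using F by (simp add: u_def surj_f_inv_f)
  have "F i x - F i l < \<delta> \<longleftrightarrow> x < u i" for i x
    using strict_mono_less[OF F(1), of i x "u i"] by (auto simp: Fu)
  moreover have "l < u i" for i
    using strict_mono_less[OF F(1), of i l "u i"] \<open>0 < \<delta>\<close> by (auto simp: Fu)
  ultimately show ?thesis
    using \<open>0 < q\<close> by (intro exI[of _ "Min (u ` {..<q})"]) (auto simp: lessThan_empty_iff)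
qed

text \<open>The hypotheses are symmetric under exchanging \<open>f\<close> and \<open>h\<close> together with the direction of
  time, so the lemma serves both orientations of the dynamics on the arc.\<close>

lemma exists_balanced_circle_point:
  assumes F: "degree_one_lift F f"
    and hf: "\<And>z. z \<in> unit_circle \<Longrightarrow> h (f z) = z" and fh: "\<And>z. z \<in> unit_circle \<Longrightarrow> f (h z) = z"
    and q: "0 < q" and \<epsilon>: "0 < \<epsilon>" and lr: "l < r" "r \<le> l + 1"
    and attr: "\<And>z. z \<in> circle_point ` {l<..<r} \<Longrightarrow>
      (\<lambda>n. dist_right_end (circle_point r) ((f ^^ (n * q)) z)) \<longlonglongrightarrow> 0"
    and rep: "\<And>z. z \<in> circle_point ` {l<..<r} \<Longrightarrow>
      (\<lambda>n. dist_left_end (circle_point l) ((h ^^ (n * q)) z)) \<longlonglongrightarrow> 0"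
  shows "\<exists>c\<in>{l<..<r}.
    (\<forall>z\<in>circle_point ` {c..<r}. \<forall>n.
      orbit_close h q \<epsilon> dist_left_end (circle_point l) n z \<longrightarrow>
      orbit_close f q \<epsilon> dist_right_end (circle_point r) n z) \<and>
    (\<forall>z\<in>circle_point ` {l<..c}. \<forall>n.
      orbit_close f q \<epsilon> dist_right_end (circle_point r) n z \<longrightarrow>
      orbit_close h q \<epsilon> dist_left_end (circle_point l) n z)"
proof -
  have H: "degree_one_lift (inv F) h" by (rule degree_one_lift_inv[OF F hf])
  obtain m where m: "l < m" "m < r" using lr dense by blast
  then have mz: "circle_point m \<in> circle_point ` {l<..<r}" by auto
  have fix_r: "(f ^^ q) (circle_point r) = circle_point r"
    by (rule attracting_end_fixed[where d = dist_right_end, OF F _ _ _ attr[OF mz]]) auto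
  have "(h ^^ q) (circle_point l) = circle_point l"
    by (rule attracting_end_fixed[where d = dist_left_end, OF H _ _ _ rep[OF mz]]) auto
  then have fix_l: "(f ^^ q) (circle_point l) = circle_point l"
    using funpow_left_inverse[OF H fh, of "circle_point l" q] by simp
  note P = degree_one_lift_funpow[OF F, of q]
  obtain k where k: "(F ^^ q) l - l = of_int k"
    using fix_l degree_one_liftD(4)[OF P, of l] by (auto simp: circle_point_eq_iff elim: Ints_cases)
  \<comment> \<open>An arbitrary lift of \<open>f^q\<close> moves \<open>l\<close> by an integer; subtracting it gives the lift fixing \<open>l\<close>.\<close>
  define T where "T t = (F ^^ q) t - of_int k" for t
  have T: "degree_one_lift T (f ^^ q)"
    using degree_one_lift_diff_int[OF P, of k] by (simp add: T_def[abs_def])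
  define R where "R = inv T"
  have R: "degree_one_lift R (h ^^ q)"
    unfolding R_def by (rule degree_one_lift_inv[OF T funpow_left_inverse[OF F hf]])
  have bij: "bij T" using degree_one_liftD[OF T] by (simp add: bij_def strict_mono_imp_inj_on)
  have TR: "T (R x) = x" and RT: "R (T x) = x" for x
    using bij by (simp_all add: R_def bij_is_inj bij_is_surj surj_f_inv_f)
  have Tl: "T l = l" using k by (simp add: T_def)
  \<comment> \<open>\<open>T r\<close> and \<open>r\<close> differ by an integer, and both lie in \<open>(l, l + 1]\<close>.\<close>
  have Tr: "T r = r"
  proof -
    have "T r - r \<in> \<int>" using fix_r degree_one_liftD(4)[OF T, of r] by (simp add: circle_point_eq_iff)
    moreover have "l < T r" using strict_monoD[OF degree_one_liftD(1)[OF T] lr(1)] Tl by simp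
    moreover have "T r \<le> l + 1"
      using strict_mono_leD[OF degree_one_liftD(1)[OF T] lr(2)] Tl degree_one_liftD(3)[OF T, of l] by simp
    ultimately show ?thesis using lr Ints_nonzero_abs_less1[of "T r - r"] by auto
  qed
  have Rl: "R l = l" and Rr: "R r = r" using RT[of l] RT[of r] Tl Tr by simp_all
  note Tn = degree_one_lift_funpow[OF T] and Rn = degree_one_lift_funpow[OF R]
  have Tn_fix: "(T ^^ n) l = l" "(T ^^ n) r = r" and Rn_fix: "(R ^^ n) l = l" "(R ^^ n) r = r" for n
    by (induction n) (simp_all add: Tl Tr Rl Rr)
  have Tn_in: "l < (T ^^ n) x \<and> (T ^^ n) x < r" and Rn_in: "l < (R ^^ n) x \<and> (R ^^ n) x < r"
    if "l < x" "x < r" for n x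
    using that strict_monoD[OF degree_one_liftD(1)[OF Tn[of n]]]
      strict_monoD[OF degree_one_liftD(1)[OF Rn[of n]]] Tn_fix Rn_fix by metis+
  have f_orbit: "(f ^^ (n * q + i)) (circle_point x) = circle_point ((F ^^ i) ((T ^^ n) x))" for n i x
    using degree_one_liftD(4)[OF Tn[of n], of x]
      degree_one_liftD(4)[OF degree_one_lift_funpow[OF F, of i]]
    by (simp add: funpow_mult_add)
  have h_orbit: "(h ^^ (n * q + i)) (circle_point x) = circle_point ((inv F ^^ i) ((R ^^ n) x))" for n i x
    using degree_one_liftD(4)[OF Rn[of n], of x]
      degree_one_liftD(4)[OF degree_one_lift_funpow[OF H, of i]]
    by (simp add: funpow_mult_add)
  \<comment> \<open>All points of the open arc lie less than one turn away from its ends, also when the arc is the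
    whole circle cut at one point. So the lifted iterates measure the distances exactly.\<close>
  have right_dist: "dist_right_end ((f ^^ i) (circle_point r)) ((f ^^ (n * q + i)) (circle_point x)) =
      2 * pi * ((F ^^ i) r - (F ^^ i) ((T ^^ n) x))" if x: "l < x" "x < r" for n i x
  proof -
    note Fi = degree_one_lift_funpow[OF F, of i]
    have "(T ^^ n) x < r" "r < (T ^^ n) x + 1" using Tn_in[OF x, of n] lr by auto
    then have "(F ^^ i) ((T ^^ n) x) < (F ^^ i) r" "(F ^^ i) r < (F ^^ i) ((T ^^ n) x) + 1"
      using strict_monoD[OF degree_one_liftD(1)[OF Fi]] by (auto simp flip: degree_one_liftD(3)[OF Fi])
    then show ?thesis
      by (simp add: dist_right_end_def f_orbit degree_one_liftD(4)[OF Fi] arc_length_circle_point_less)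
  qed
  have left_dist: "dist_left_end ((h ^^ i) (circle_point l)) ((h ^^ (n * q + i)) (circle_point x)) =
      2 * pi * ((inv F ^^ i) ((R ^^ n) x) - (inv F ^^ i) l)" if x: "l < x" "x < r" for n i x
  proof -
    note Hi = degree_one_lift_funpow[OF H, of i]
    have "l < (R ^^ n) x" "(R ^^ n) x < l + 1" using Rn_in[OF x, of n] lr by auto
    then have "(inv F ^^ i) l < (inv F ^^ i) ((R ^^ n) x)"
        "(inv F ^^ i) ((R ^^ n) x) < (inv F ^^ i) l + 1"
      using strict_monoD[OF degree_one_liftD(1)[OF Hi]] degree_one_liftD(3)[OF Hi, of l] by metis+
    then show ?thesis
      by (simp add: dist_left_end_def h_orbit degree_one_liftD(4)[OF Hi] arc_length_circle_point_less)
  qed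
  have "0 < \<epsilon> / (2 * pi)" using \<epsilon> by simp
  then obtain u where u: "u < r" and
      u_iff: "\<And>x. (\<forall>i<q. (F ^^ i) r - (F ^^ i) x < \<epsilon> / (2 * pi)) \<longleftrightarrow> u < x"
    using near_right_threshold[of "\<lambda>i. F ^^ i" q "\<epsilon> / (2 * pi)" r] q
      degree_one_liftD(1,2)[OF degree_one_lift_funpow[OF F]] by blast
  from \<open>0 < \<epsilon> / (2 * pi)\<close> obtain d where d: "l < d" and
      d_iff: "\<And>x. (\<forall>i<q. (inv F ^^ i) x - (inv F ^^ i) l < \<epsilon> / (2 * pi)) \<longleftrightarrow> x < d"
    using near_left_threshold[of "\<lambda>i. inv F ^^ i" q "\<epsilon> / (2 * pi)" l] q
      degree_one_liftD(1,2)[OF degree_one_lift_funpow[OF H]] by blast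
  have close_right: "orbit_close f q \<epsilon> dist_right_end (circle_point r) n (circle_point x) \<longleftrightarrow> u < (T ^^ n) x"
    and close_left: "orbit_close h q \<epsilon> dist_left_end (circle_point l) n (circle_point x) \<longleftrightarrow> (R ^^ n) x < d"
    if "l < x" "x < r" for n x
    using that unfolding orbit_close_def u_iff[symmetric] d_iff[symmetric]
    by (simp_all add: right_dist left_dist pos_less_divide_eq mult.commute[of _ "2 * pi"])
  have T_lim: "(\<lambda>n. (T ^^ n) x) \<longlonglongrightarrow> r" if x: "l < x" "x < r" for x
  proof -
    have "(\<lambda>n. 2 * pi * (r - (T ^^ n) x)) \<longlonglongrightarrow> 0"
      using attr[of "circle_point x"] right_dist[OF x, of 0] x by simp
    then have "(\<lambda>n. r - 2 * pi * (r - (T ^^ n) x) / (2 * pi)) \<longlonglongrightarrow> r - 0 / (2 * pi)"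
      by (intro tendsto_intros) auto
    then show ?thesis by simp
  qed
  have R_lim: "(\<lambda>n. (R ^^ n) x) \<longlonglongrightarrow> l" if x: "l < x" "x < r" for x
  proof -
    have "(\<lambda>n. 2 * pi * ((R ^^ n) x - l)) \<longlonglongrightarrow> 0"
      using rep[of "circle_point x"] left_dist[OF x, of 0] x by simp
    then have "(\<lambda>n. l + 2 * pi * ((R ^^ n) x - l) / (2 * pi)) \<longlonglongrightarrow> l + 0 / (2 * pi)"
      by (intro tendsto_intros) auto
    then show ?thesis by simp
  qed
  obtain c where c: "l < c" "c < r" and bal: "\<And>n. u < (T ^^ n) c \<longleftrightarrow> (R ^^ n) c < d"
    using balanced_point[OF degree_one_liftD(1)[OF T] degree_one_liftD(1)[OF R] TR RT Tl Tr lr(1)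
        T_lim R_lim u d] by blast
  have Tn_mono: "(T ^^ n) x \<le> (T ^^ n) y" and Rn_mono: "(R ^^ n) x \<le> (R ^^ n) y" if "x \<le> y" for x y n
    using that strict_mono_leD[OF degree_one_liftD(1)[OF Tn]] strict_mono_leD[OF degree_one_liftD(1)[OF Rn]]
    by blast+
  show ?thesis
  proof (intro bexI[of _ c] conjI ballI allI impI)
    fix z n
    assume "z \<in> circle_point ` {c..<r}"
      and left: "orbit_close h q \<epsilon> dist_left_end (circle_point l) n z"
    then obtain x where x: "z = circle_point x" "c \<le> x" "x < r" by auto
    then have "(R ^^ n) c < d"
      using left close_left[of x n] c Rn_mono[OF x(2), of n] by auto
    then show "orbit_close f q \<epsilon> dist_right_end (circle_point r) n z"
      using close_right[of x n] bal[of n] x c Tn_mono[OF x(2), of n] by auto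
  next
    fix z n
    assume "z \<in> circle_point ` {l<..c}"
      and right: "orbit_close f q \<epsilon> dist_right_end (circle_point r) n z"
    then obtain x where x: "z = circle_point x" "l < x" "x \<le> c" by auto
    then have "u < (T ^^ n) c"
      using right close_right[of x n] c Tn_mono[OF x(3), of n] by auto
    then show "orbit_close h q \<epsilon> dist_left_end (circle_point l) n z"
      using close_left[of x n] bal[of n] x c Rn_mono[OF x(3), of n] by auto
  qed (use c in auto)
qed

section \<open>Cut points of arcs between periodic points\<close>

lemma circle_iterate_of_nat:
  "circle_iterate \<phi> (int n) = \<phi> ^^ n"
  "circle_iterate \<phi> (- int n) = inv_into unit_circle \<phi> ^^ n"
  by (auto simp: circle_iterate_def)

lemma forward_close_eq: "forward_close \<phi> q \<epsilon> d e n z \<longleftrightarrow> orbit_close \<phi> q \<epsilon> d e n z"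
  unfolding forward_close_def orbit_close_def of_nat_add[symmetric] circle_iterate_of_nat ..

text \<open>The end-point at step \<open>i\<close> is given as \<open>\<phi>^(q - i)(e)\<close>; since \<open>\<phi>^q\<close> fixes \<open>e\<close>, this is the
  \<open>i\<close>-th preimage of \<open>e\<close>.\<close>

lemma backward_close_eq:
  assumes F: "degree_one_lift F \<phi>"
    and inv: "\<And>w. w \<in> unit_circle \<Longrightarrow> inv_into unit_circle \<phi> (\<phi> w) = w"
    and e: "e \<in> unit_circle" and fix_e: "(\<phi> ^^ q) e = e"
  shows "backward_close \<phi> q \<epsilon> d e n z \<longleftrightarrow> orbit_close (inv_into unit_circle \<phi>) q \<epsilon> d e n z"
proof -
  have e_orbit: "circle_iterate \<phi> (int q - int i) e = (inv_into unit_circle \<phi> ^^ i) e" if "i < q" for i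
  proof -
    have "(\<phi> ^^ i) ((\<phi> ^^ (q - i)) e) = e"
      using that fix_e by (simp flip: funpow_add[THEN fun_cong, unfolded o_apply])
    then have "(inv_into unit_circle \<phi> ^^ i) e = (\<phi> ^^ (q - i)) e"
      using funpow_left_inverse[OF F inv funpow_in_unit_circle[OF F e, of "q - i"], of i] by simp
    then show ?thesis using that by (simp add: circle_iterate_of_nat flip: of_nat_diff)
  qed
  have "- int (n * q) - int i = - int (n * q + i)" for i by simp
  then show ?thesis
    unfolding backward_close_def orbit_close_def by (simp only: circle_iterate_of_nat) (simp add: e_orbit)
qed

lemma attracting_within_iff:
  "attracting_within \<phi> q I d e \<longleftrightarrow> (\<forall>z\<in>I. (\<lambda>n. d e ((\<phi> ^^ (n * q)) z)) \<longlonglongrightarrow> 0)"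
  unfolding attracting_within_def circle_iterate_of_nat ..

lemma repelling_within_iff:
  "repelling_within \<phi> q I d e \<longleftrightarrow>
    (\<forall>z\<in>I. (\<lambda>n. d e ((inv_into unit_circle \<phi> ^^ (n * q)) z)) \<longlonglongrightarrow> 0)"
  unfolding repelling_within_def circle_iterate_of_nat ..

text \<open>In the first part \<open>\<phi>\<close> moves points to the right; the second part is the first one for
  the inverse of \<open>\<phi>\<close>, with forward and backward closeness exchanged. Stating both for
  \<open>r \<le> l + 1\<close> covers the arc between two distinct points and the circle cut at one point.\<close>

lemma balanced_point_of_arc:
  assumes hom: "orientation_preserving_circle_homeo \<phi>"
    and q: "0 < q" and \<epsilon>: "0 < \<epsilon>" and lr: "l < r" "r \<le> l + 1"
    and a: "a = circle_point l" and b: "b = circle_point r" and I: "I = circle_point ` {l<..<r}"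
  shows "\<lbrakk>attracting_within \<phi> q I dist_right_end b; repelling_within \<phi> q I dist_left_end a\<rbrakk> \<Longrightarrow>
      \<exists>c\<in>I.
        (\<forall>z\<in>arc_co c b. \<forall>n.
          backward_close \<phi> q \<epsilon> dist_left_end a n z \<longrightarrow> forward_close \<phi> q \<epsilon> dist_right_end b n z) \<and>
        (\<forall>z\<in>arc_oc a c. \<forall>n.
          forward_close \<phi> q \<epsilon> dist_right_end b n z \<longrightarrow> backward_close \<phi> q \<epsilon> dist_left_end a n z)"
      (is "\<lbrakk>?attr_right; ?rep_left\<rbrakk> \<Longrightarrow> ?balance_right")
    and "\<lbrakk>attracting_within \<phi> q I dist_left_end a; repelling_within \<phi> q I dist_right_end b\<rbrakk> \<Longrightarrow>
      \<exists>c\<in>I.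
        (\<forall>z\<in>arc_oc a c. \<forall>n.
          backward_close \<phi> q \<epsilon> dist_right_end b n z \<longrightarrow> forward_close \<phi> q \<epsilon> dist_left_end a n z) \<and>
        (\<forall>z\<in>arc_co c b. \<forall>n.
          forward_close \<phi> q \<epsilon> dist_left_end a n z \<longrightarrow> backward_close \<phi> q \<epsilon> dist_right_end b n z)"
      (is "\<lbrakk>?attr_left; ?rep_right\<rbrakk> \<Longrightarrow> ?balance_left")
proof -
  let ?\<psi> = "inv_into unit_circle \<phi>"
  obtain F where F: "degree_one_lift F \<phi>" by (rule obtain_degree_one_lift[OF hom])
  have bij: "bij_betw \<phi> unit_circle unit_circle"
    using hom by (auto simp: orientation_preserving_circle_homeo_def homeomorphism_def
        intro!: bij_betw_byWitness)
  have inv: "?\<psi> (\<phi> w) = w" "\<phi> (?\<psi> w) = w" if "w \<in> unit_circle" for w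
    using bij that by (auto simp: bij_betw_def f_inv_into_f)
  have H: "degree_one_lift (inv F) ?\<psi>" by (rule degree_one_lift_inv[OF F inv(1)])
  obtain m where "l < m" "m < r" using lr dense by blast
  then have m: "circle_point m \<in> I" by (auto simp: I)
  have on_circle: "a \<in> unit_circle" "b \<in> unit_circle" "circle_point m \<in> unit_circle"
    by (simp_all add: a b)
  \<comment> \<open>Backward closeness is expressed by the inverse only at ends fixed by \<open>\<phi>^q\<close>. These are here the
    repelling ends, which are limits of orbits of the inverse.\<close>
  have fixed: "(\<phi> ^^ q) e = e"
    if e: "e \<in> unit_circle" and d: "d = dist_right_end \<or> d = dist_left_end"
      and "repelling_within \<phi> q I d e" for e d
  proof -
    have "(?\<psi> ^^ q) e = e"
      using that m by (intro attracting_end_fixed[OF H on_circle(3) e d]) (auto simp: repelling_within_iff)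
    then show ?thesis using funpow_left_inverse[OF H inv(2) e, of q] by simp
  qed
  have cut: "circle_point c \<in> I" "arc_co (circle_point c) b = circle_point ` {c..<r}"
    "arc_oc a (circle_point c) = circle_point ` {l<..c}" if "c \<in> {l<..<r}" for c
    using that lr by (auto simp: I a b arc_co_circle_point arc_oc_circle_point)
  show ?balance_right if attr: ?attr_right and rep: ?rep_left
  proof -
    note close = forward_close_eq
      backward_close_eq[OF F inv(1) on_circle(1) fixed[OF on_circle(1) _ rep], simplified]
    have "\<exists>c\<in>{l<..<r}.
        (\<forall>z\<in>circle_point ` {c..<r}. \<forall>n.
          backward_close \<phi> q \<epsilon> dist_left_end a n z \<longrightarrow> forward_close \<phi> q \<epsilon> dist_right_end b n z) \<and>
        (\<forall>z\<in>circle_point ` {l<..c}. \<forall>n.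
          forward_close \<phi> q \<epsilon> dist_right_end b n z \<longrightarrow> backward_close \<phi> q \<epsilon> dist_left_end a n z)"
      using exists_balanced_circle_point[OF F inv q \<epsilon> lr] attr rep
      unfolding close unfolding attracting_within_iff repelling_within_iff I a b by blast
    then show ?thesis by (metis cut)
  qed
  show ?balance_left if attr: ?attr_left and rep: ?rep_right
  proof -
    note close = forward_close_eq
      backward_close_eq[OF F inv(1) on_circle(2) fixed[OF on_circle(2) _ rep], simplified]
    have "\<exists>c\<in>{l<..<r}.
        (\<forall>z\<in>circle_point ` {l<..c}. \<forall>n.
          backward_close \<phi> q \<epsilon> dist_right_end b n z \<longrightarrow> forward_close \<phi> q \<epsilon> dist_left_end a n z) \<and>
        (\<forall>z\<in>circle_point ` {c..<r}. \<forall>n.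
          forward_close \<phi> q \<epsilon> dist_left_end a n z \<longrightarrow> backward_close \<phi> q \<epsilon> dist_right_end b n z)"
      using exists_balanced_circle_point[OF H inv(2,1) q \<epsilon> lr] attr rep
      unfolding close unfolding attracting_within_iff repelling_within_iff I a b by blast
    then show ?thesis by (metis cut)
  qed
qed

theorem proposition2p6:
  fixes \<phi> :: "complex \<Rightarrow> complex" and p :: int and q :: nat and \<epsilon> :: real
  assumes "orientation_preserving_circle_homeo \<phi>"
    and "0 < q" and "coprime p (int q)"
    and "rotation_number \<phi> = frac (real_of_int p / real q)"
    and "finite (periodic_points \<phi>)"
    and "0 < \<epsilon>"
  shows
    "(\<forall>a b. consecutive_periodic_points \<phi> a b \<and>
        attracting_within \<phi> q (arc_oo a b) dist_right_end b \<and>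
        repelling_within \<phi> q (arc_oo a b) dist_left_end a \<longrightarrow>
        (\<exists>c\<in>arc_oo a b.
          (\<forall>z\<in>arc_co c b. \<forall>n.
            backward_close \<phi> q \<epsilon> dist_left_end a n z \<longrightarrow> forward_close \<phi> q \<epsilon> dist_right_end b n z) \<and>
          (\<forall>z\<in>arc_oc a c. \<forall>n.
            forward_close \<phi> q \<epsilon> dist_right_end b n z \<longrightarrow> backward_close \<phi> q \<epsilon> dist_left_end a n z))) \<and>
     (\<forall>a b. consecutive_periodic_points \<phi> a b \<and>
        attracting_within \<phi> q (arc_oo a b) dist_left_end a \<and>
        repelling_within \<phi> q (arc_oo a b) dist_right_end b \<longrightarrow>
        (\<exists>c\<in>arc_oo a b.
          (\<forall>z\<in>arc_oc a c. \<forall>n.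
            backward_close \<phi> q \<epsilon> dist_right_end b n z \<longrightarrow> forward_close \<phi> q \<epsilon> dist_left_end a n z) \<and>
          (\<forall>z\<in>arc_co c b. \<forall>n.
            forward_close \<phi> q \<epsilon> dist_left_end a n z \<longrightarrow> backward_close \<phi> q \<epsilon> dist_right_end b n z))) \<and>
     (\<forall>z0. periodic_points \<phi> = {z0} \<longrightarrow>
        (attracting_within \<phi> q (unit_circle - {z0}) dist_right_end z0 \<and>
         repelling_within \<phi> q (unit_circle - {z0}) dist_left_end z0 \<longrightarrow>
          (\<exists>c\<in>unit_circle - {z0}.
            (\<forall>z\<in>arc_co c z0. \<forall>n.
              backward_close \<phi> q \<epsilon> dist_left_end z0 n z \<longrightarrow> forward_close \<phi> q \<epsilon> dist_right_end z0 n z) \<and>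
            (\<forall>z\<in>arc_oc z0 c. \<forall>n.
              forward_close \<phi> q \<epsilon> dist_right_end z0 n z \<longrightarrow> backward_close \<phi> q \<epsilon> dist_left_end z0 n z) \<and>
            unit_circle - {z0} = arc_co c z0 \<union> arc_oc z0 c \<and>
            arc_co c z0 \<inter> arc_oc z0 c = {c})) \<and>
        (attracting_within \<phi> q (unit_circle - {z0}) dist_left_end z0 \<and>
         repelling_within \<phi> q (unit_circle - {z0}) dist_right_end z0 \<longrightarrow>
          (\<exists>c\<in>unit_circle - {z0}.
            (\<forall>z\<in>arc_oc z0 c. \<forall>n.
              backward_close \<phi> q \<epsilon> dist_right_end z0 n z \<longrightarrow> forward_close \<phi> q \<epsilon> dist_left_end z0 n z) \<and>
            (\<forall>z\<in>arc_co c z0. \<forall>n.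
              forward_close \<phi> q \<epsilon> dist_left_end z0 n z \<longrightarrow> backward_close \<phi> q \<epsilon> dist_right_end z0 n z) \<and>
            unit_circle - {z0} = arc_oc z0 c \<union> arc_co c z0 \<and>
            arc_oc z0 c \<inter> arc_co c z0 = {c})))"
proof (intro conjI allI impI; (elim conjE)?)
  note balance = balanced_point_of_arc[OF assms(1,2,6)]
  have arc: "\<exists>l r. l < r \<and> r \<le> l + 1 \<and> a = circle_point l \<and> b = circle_point r \<and>
      arc_oo a b = circle_point ` {l<..<r}"
    if per: "consecutive_periodic_points \<phi> a b" for a b
  proof -
    have "a \<noteq> b" and ab: "a \<in> unit_circle" "b \<in> unit_circle"
      using per by (auto simp: consecutive_periodic_points_def periodic_points_def)
    then obtain l where l: "a = circle_point l" by (auto simp: unit_circle_eq[of 0])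
    then have "b \<in> circle_point ` {l<..<l + 1}" using ab \<open>a \<noteq> b\<close> punctured_circle_eq[of l] by auto
    then obtain r where "l < r" "r < l + 1" "b = circle_point r" by auto
    then show ?thesis using l arc_oo_circle_point by (intro exI[of _ l] exI[of _ r]) simp
  qed
  show "\<exists>c\<in>arc_oo a b.
      (\<forall>z\<in>arc_co c b. \<forall>n.
        backward_close \<phi> q \<epsilon> dist_left_end a n z \<longrightarrow> forward_close \<phi> q \<epsilon> dist_right_end b n z) \<and>
      (\<forall>z\<in>arc_oc a c. \<forall>n.
        forward_close \<phi> q \<epsilon> dist_right_end b n z \<longrightarrow> backward_close \<phi> q \<epsilon> dist_left_end a n z)"
    if "consecutive_periodic_points \<phi> a b" "attracting_within \<phi> q (arc_oo a b) dist_right_end b"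
      "repelling_within \<phi> q (arc_oo a b) dist_left_end a" for a b
    using arc[OF that(1)] balance(1)[OF _ _ _ _ _ that(2,3)] by blast
  show "\<exists>c\<in>arc_oo a b.
      (\<forall>z\<in>arc_oc a c. \<forall>n.
        backward_close \<phi> q \<epsilon> dist_right_end b n z \<longrightarrow> forward_close \<phi> q \<epsilon> dist_left_end a n z) \<and>
      (\<forall>z\<in>arc_co c b. \<forall>n.
        forward_close \<phi> q \<epsilon> dist_left_end a n z \<longrightarrow> backward_close \<phi> q \<epsilon> dist_right_end b n z)"
    if "consecutive_periodic_points \<phi> a b" "attracting_within \<phi> q (arc_oo a b) dist_left_end a"
      "repelling_within \<phi> q (arc_oo a b) dist_right_end b" for a b
    using arc[OF that(1)] balance(2)[OF _ _ _ _ _ that(2,3)] by blast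
  fix z0 assume "periodic_points \<phi> = {z0}"
  then have z0: "z0 \<in> unit_circle" by (auto simp: periodic_points_def)
  then obtain l where l: "z0 = circle_point l" by (auto simp: unit_circle_eq[of 0])
  \<comment> \<open>The coordinates \<open>l\<close> and \<open>l + 1\<close> of \<open>z0\<close> stand for the two ends of the cut circle.\<close>
  have l1: "z0 = circle_point (l + 1)" by (simp add: l circle_point_eq_iff)
  note balance0 = balance[OF _ order_refl l l1 punctured_circle_eq[of l, folded l], simplified]
    and cut = punctured_circle_cut[OF z0]
  show "\<exists>c\<in>unit_circle - {z0}.
      (\<forall>z\<in>arc_co c z0. \<forall>n.
        backward_close \<phi> q \<epsilon> dist_left_end z0 n z \<longrightarrow> forward_close \<phi> q \<epsilon> dist_right_end z0 n z) \<and>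
      (\<forall>z\<in>arc_oc z0 c. \<forall>n.
        forward_close \<phi> q \<epsilon> dist_right_end z0 n z \<longrightarrow> backward_close \<phi> q \<epsilon> dist_left_end z0 n z) \<and>
      unit_circle - {z0} = arc_co c z0 \<union> arc_oc z0 c \<and>
      arc_co c z0 \<inter> arc_oc z0 c = {c}"
    if "attracting_within \<phi> q (unit_circle - {z0}) dist_right_end z0"
      "repelling_within \<phi> q (unit_circle - {z0}) dist_left_end z0"
    using balance0(1)[OF that] cut by (elim bexE) (rule bexI, blast+)
  show "\<exists>c\<in>unit_circle - {z0}.
      (\<forall>z\<in>arc_oc z0 c. \<forall>n.
        backward_close \<phi> q \<epsilon> dist_right_end z0 n z \<longrightarrow> forward_close \<phi> q \<epsilon> dist_left_end z0 n z) \<and>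
      (\<forall>z\<in>arc_co c z0. \<forall>n.
        forward_close \<phi> q \<epsilon> dist_left_end z0 n z \<longrightarrow> backward_close \<phi> q \<epsilon> dist_right_end z0 n z) \<and>
      unit_circle - {z0} = arc_oc z0 c \<union> arc_co c z0 \<and>
      arc_oc z0 c \<inter> arc_co c z0 = {c}"
    if "attracting_within \<phi> q (unit_circle - {z0}) dist_left_end z0"
      "repelling_within \<phi> q (unit_circle - {z0}) dist_right_end z0"
    using balance0(2)[OF that] cut by (elim bexE) (rule bexI, blast+)
qed

end
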